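(* For every finite simple graph $G$, $$\omega(L(G)^2)\le \frac{2607}{1987}\,\Delta(G)^2.$$
   Context: All graphs are finite and simple. $\Delta(G)$ is the maximum degree of $G$ and $\omega$ denotes the clique number (largest number of vertices in a clique). $L(G)$ denotes the line graph of $G$: its vertices are the edges of $G$, two being adjacent when they share an endpoint. For a positive integer $k$, the $k$-th power $F^k$ of a graph $F$ has vertex set $V(F)$, and two distinct vertices are adjacent in $F^k$ if and only if they are at distance at most $k$ in $F$. The quantity $\omega(L(G)^2)$ is called the strong clique index of $G$. *)

theory Defs
  imports "Graph_Theory.Graph_Theory"
begin

text \<open>
  A finite simple graph is a \<^locale>\<open>pair_graph\<close>: a finite vertex set with a symmetric and
  loop-free set of arcs, an undirected edge \<open>{u, v}\<close> being the pair of arcs \<open>(u, v)\<close>, \<open>(v, u)\<close>.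
\<close>

definition edges :: "'a pair_pre_digraph \<Rightarrow> 'a set set" where
  "edges G = {{u, v} | u v. (u, v) \<in> parcs G}"

text \<open>
  As the arcs are symmetric, the out-degree of a vertex is its number of neighbours.
  The maximum degree of the graph without vertices is 0.
\<close>

definition max_degree :: "'a pair_pre_digraph \<Rightarrow> nat" where
  "max_degree G = Max (insert 0 (out_degree (with_proj G) ` pverts G))"

definition is_clique :: "'a pair_pre_digraph \<Rightarrow> 'a set \<Rightarrow> bool" where
  "is_clique G C \<longleftrightarrow>
     C \<subseteq> pverts G \<and> (\<forall>u\<in>C. \<forall>v\<in>C. u \<noteq> v \<longrightarrow> (u, v) \<in> parcs G)"

text \<open>The empty set is a clique, so the graph without vertices has clique number 0.\<close>

definition clique_number :: "'a pair_pre_digraph \<Rightarrow> nat" where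
  "clique_number G = Max (card ` {C. is_clique G C})"

definition line_graph :: "'a pair_pre_digraph \<Rightarrow> 'a set pair_pre_digraph" where
  "line_graph G =
     \<lparr> pverts = edges G,
       parcs = {(e, f). e \<in> edges G \<and> f \<in> edges G \<and> e \<noteq> f \<and> e \<inter> f \<noteq> {}} \<rparr>"

text \<open>
  With all weights 1, the cost of a walk is its length, so \<open>wf_digraph.\<mu>\<close> is the graph
  distance (\<open>\<infinity>\<close> between different components).
\<close>

definition graph_dist :: "'a pair_pre_digraph \<Rightarrow> 'a \<Rightarrow> 'a \<Rightarrow> ereal" where
  "graph_dist F u v = wf_digraph.\<mu> (with_proj F) (\<lambda>_. 1) u v"

definition graph_power :: "'a pair_pre_digraph \<Rightarrow> nat \<Rightarrow> 'a pair_pre_digraph" where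
  "graph_power F k =
     \<lparr> pverts = pverts F,
       parcs = {(u, v). u \<in> pverts F \<and> v \<in> pverts F \<and> u \<noteq> v \<and>
                        graph_dist F u v \<le> ereal (real k)} \<rparr>"

lemma pair_graph_line_graph:
  assumes "pair_graph G"
  shows "pair_graph (line_graph G)"
proof -
  interpret pair_graph G by fact
  have "edges G = (\<lambda>(u, v). {u, v}) ` parcs G"
    by (auto simp: edges_def)
  then have fin: "finite (edges G)"
    using pair_finite_arcs by simp
  have "finite (parcs (line_graph G))"
    by (rule finite_subset[of _ "edges G \<times> edges G"]) (auto simp: line_graph_def fin)
  then show ?thesis
    by unfold_locales (auto simp: line_graph_def fin symmetric_def intro!: symI)
qed

lemma graph_dist_le_iff:
  assumes "wf_digraph (with_proj F)"
  shows "graph_dist F u v \<le> ereal (real k) \<longleftrightarrow>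
    (\<exists>p. pre_digraph.awalk (with_proj F) u p v \<and> length p \<le> k)"
proof -
  interpret wf_digraph "with_proj F" by fact
  have c: "awalk_cost (\<lambda>_. 1) p = real (length p)" for p :: "('a\<times>'a) list"
    by (induct p) auto
  show ?thesis
  proof
    assume "graph_dist F u v \<le> ereal (real k)"
    then have "graph_dist F u v < ereal (real k + 1)"
      by (rule le_less_trans) simp
    then show "\<exists>p. awalk u p v \<and> length p \<le> k"
      unfolding graph_dist_def \<mu>_def INF_less_iff c by auto
  next
    assume "\<exists>p. awalk u p v \<and> length p \<le> k"
    then show "graph_dist F u v \<le> ereal (real k)"
      unfolding graph_dist_def \<mu>_def c by (auto intro: INF_lower2)
  qed
qed

end

theory Submission
  imports Defs
begin

text \<open>
  Let \<open>H\<close> be a clique of the square of the line graph, regarded as a set of edges of \<open>G\<close>. Then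
  any two edges of \<open>H\<close> are joined by an edge of \<open>G\<close>, and this is what the proof exploits. Write \<open>d\<close> for the maximum degree, \<open>N(z)\<close>
  for the neighbourhood of \<open>z\<close> in \<open>G\<close> and \<open>h(z)\<close> for its degree in \<open>H\<close>.

  Fix an edge \<open>zw\<close> of \<open>H\<close>. Every edge of \<open>H\<close> has an endpoint in \<open>N(z) \<union> N(w)\<close>. Hence, in
  \<open>\<Sum>h(v)\<close> over \<open>v \<in> N(z)\<close> plus the same sum over \<open>N(w)\<close>, each edge is counted at least twice, except
  for edges with one endpoint outside \<open>N(z) \<union> N(w)\<close> and the other one in exactly one of \<open>N(z)\<close> and
  \<open>N(w)\<close>. The exceptional edges that meet \<open>N(z) - N(w)\<close> form a bipartite set in \<open>G - N(w)\<close>. Each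
  \<open>H\<close>-neighbour of \<open>w\<close> lies in \<open>N(w)\<close> and is adjacent to an endpoint of each of them, so their
  endpoints have degree sum at most \<open>2 * d - h(w)\<close> in \<open>G - N(w)\<close>.

  The main step is a bound for such bipartite sets: if any two edges of a bipartite set of edges are
  joined by an edge, and the two endpoints of each have degree sum at most \<open>s\<close>, then there are at
  most \<open>c * s\<^sup>2\<close> of them, with \<open>c = 39/125\<close> (\<open>strong_bipartite_card_le\<close>). The bound
  for \<open>H\<close> follows by averaging over the edges \<open>zw\<close> (\<open>strong_arcs.card_arcs_le\<close>): the worst case
  is \<open>h = d\<close> at all vertices, which gives \<open>card H \<le> (1 + c) * d\<^sup>2\<close>, and \<open>1 + c = 164/125\<close> is less
  than \<open>2607/1987\<close>.

  The bipartite bound is proved by induction on the number of vertices. Let \<open>v0\<close> be a vertex whose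
  degree \<open>q\<close> in the bipartite set is largest, and \<open>X\<close> its neighbourhood there. The edges that have
  no endpoint in \<open>N(v0)\<close> again satisfy the hypotheses, now with \<open>s - q\<close>, because each vertex of \<open>X\<close>
  is adjacent to an endpoint of each of them. The edges that meet \<open>N(v0)\<close> number at most
  \<open>q * (s - q)\<close>. These two estimates alone would only give \<open>c = 1/2\<close>. They cannot both be sharp: an
  edge \<open>yv\<close> far from \<open>v0\<close> forces adjacencies between \<open>y\<close> and those vertices of \<open>X\<close> that are not
  adjacent to \<open>v\<close>. These use up degree at the vertices of \<open>X\<close> and so lower the first number, and
  they also use up degree at \<open>y\<close>, which limits the number of far edges that can share them. The
  lemma \<open>strong_bipartite.root_step\<close> measures this trade-off.
\<close>

section \<open>Two inequalities between real numbers\<close>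

text \<open>
  This estimates what a single vertex \<open>v\<close> outside \<open>N(v0)\<close> can contribute. It has \<open>f\<close> far edges,
  \<open>n\<close> neighbours in \<open>X\<close> that are not joined to it by an edge of the set, and \<open>q - h + f - n\<close>
  non-neighbours in \<open>X\<close>, while \<open>h\<close> counts its far edges and its edges to \<open>X\<close>; the quotient by \<open>mu\<close> is its share of the degree that is lost in \<open>X\<close>. What
  matters is that the right side is proportional to \<open>h\<close>, as the values \<open>h\<close> have a bounded sum. If
  \<open>f \<le> mu\<close>, the proof reduces to \<open>n = 0\<close> and then to \<open>h = q\<close>, where the gain is \<open>f * (1 - f / mu)\<close>: its maximum
  over \<open>f\<close> is \<open>q / 4\<close> for \<open>mu = q\<close> and \<open>(3 - 2 * sqrt 2) * b\<close> for \<open>mu = b - f\<close>, and \<open>43/250\<close>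
  slightly exceeds \<open>3 - 2 * sqrt 2\<close>.
\<close>

lemma gain_bound:
  fixes f h n q b :: real
  assumes f: "0 \<le> f" "f \<le> h" "h \<le> q" and n: "0 \<le> n" "n \<le> q - h + f" and q: "0 < q" and b: "f < b"
  defines "mu \<equiv> min q (b - f)"
  shows "f - n - f * (q - h + f - n) / mu \<le> h * min (1/4) (43/250 * b / q)"
proof -
  have mu: "0 < mu" "mu \<le> q" "mu \<le> b - f"
    using q b by (auto simp: mu_def)
  let ?c = "q - h + f"
  have rhs: "0 \<le> h * min (1/4) (43/250 * b / q)"
    using assms by (auto intro!: mult_nonneg_nonneg)
  show ?thesis
  proof (cases "f \<le> mu")
    case False
    \<comment> \<open>The left side is affine in \<open>n\<close> and is not positive at the ends \<open>0\<close> and \<open>q - h + f\<close> of its range.\<close>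
    have "mu * (f - n) - f * (?c - n) \<le> 0"
    proof -
      have "mu * (f - n) - f * (?c - n) = (mu - f) * (f - n) - f * (q - h)"
        by (simp add: algebra_simps)
      moreover have "(mu - f) * (f - n) \<le> f * (q - h)"
      proof (cases "n \<le> f")
        case True
        then have "(mu - f) * (f - n) \<le> 0" using False
          by (intro mult_nonpos_nonneg) auto
        also have "0 \<le> f * (q - h)" using f by simp
        finally show ?thesis .
      next
        case nf: False
        have "(mu - f) * (f - n) = (f - mu) * (n - f)" by (simp add: algebra_simps)
        also have "\<dots> \<le> f * (q - h)"
          using False nf mu n f by (intro mult_mono) auto
        finally show ?thesis .
      qed
      ultimately show ?thesis by simp
    qed
    then have "f - n - f * (?c - n) / mu \<le> 0"
      using mu by (simp add: field_simps)
    then show ?thesis using rhs by simp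
  next
    case True
    have "f - n - f * (?c - n) / mu = f - f * ?c / mu - n * (1 - f / mu)"
      using mu by (simp add: field_simps)
    also have "\<dots> \<le> f - f * ?c / mu"
      using True n mu by simp
    also have "\<dots> = f * (1 - ?c / mu)" by (simp add: algebra_simps)
    also have "\<dots> \<le> f * (h / q * (1 - f / mu))"
    proof (intro mult_left_mono f)
      have "h / q * (1 - f / mu) - (1 - ?c / mu) = (q - h) * (q + f - mu) / (q * mu)"
        using q mu by (simp add: divide_simps) (simp add: algebra_simps)
      also have "0 \<le> \<dots>"
        using f mu q by (intro divide_nonneg_pos mult_nonneg_nonneg) auto
      finally show "1 - ?c / mu \<le> h / q * (1 - f / mu)" by simp
    qed
    also have "\<dots> = h * (f * (1 - f / mu) / q)" by simp
    also have "\<dots> \<le> h * min (1/4) (43/250 * b / q)"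
    proof (intro mult_left_mono)
      have "f * (1 - f / mu) \<le> f * (1 - f / q)"
        using f mu q by (intro mult_left_mono) (auto intro!: divide_left_mono)
      also have "\<dots> \<le> q / 4"
      proof -
        have "0 \<le> (q - 2 * f)\<^sup>2" by simp
        then show ?thesis using q by (simp add: field_simps power2_eq_square)
      qed
      finally have 1: "f * (1 - f / mu) / q \<le> 1/4"
        using q by (simp add: field_simps)
      have "f * (1 - f / mu) \<le> f * (1 - f / (b - f))"
        using f mu q b by (intro mult_left_mono) (auto intro!: divide_left_mono)
      also have "\<dots> \<le> 43/250 * b"
      proof -
        \<comment> \<open>The quadratic form \<open>2 * f\<^sup>2 - 1.172 * f * b + 0.172 * b\<^sup>2\<close>, with the square completed.\<close>
        have "0 \<le> 2 * (f - 293/1000 * b)\<^sup>2 + 302/1000000 * b\<^sup>2" by simp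
        then have "f * (b - 2 * f) \<le> 43/250 * b * (b - f)"
          by (simp add: power2_eq_square algebra_simps)
        then show ?thesis using b by (simp add: field_simps)
      qed
      finally have "f * (1 - f / mu) \<le> 43/250 * b" .
      then have "f * (1 - f / mu) / q \<le> 43/250 * b / q"
        by (rule divide_right_mono) (use q in simp)
      with 1 show "f * (1 - f / mu) / q \<le> min (1/4) (43/250 * b / q)" by simp
    qed (use f in auto)
    finally show ?thesis .
  qed
qed

text \<open>
  Here \<open>q + b\<close> plays the role of \<open>s\<close>. This inequality is what the constant \<open>39/125\<close> is chosen for.
  At \<open>q = 0.41 * s\<close>, where the two terms of the minimum are nearly equal, little room is left, so the
  cases are split there and the difference of the two sides is expanded around this point.
\<close>

lemma final_bound:
  fixes q b :: real
  assumes q: "0 < q" and b: "0 \<le> b"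
  shows "q * b + (q\<^sup>2 + 39/125 * b\<^sup>2) * min (1/4) (43/250 * b / q) \<le> 39/125 * (q + b)\<^sup>2"
proof (cases "59 * q \<le> 41 * b")
  case True
  define y where "y = 41/59 * b - q"
  have y: "0 \<le> y" "q = 41/59 * b - y" using True by (auto simp: y_def)
  have "39/125 * (q + b)\<^sup>2 - (q * b + (q\<^sup>2 + 39/125 * b\<^sup>2) * (1/4))
      = 31/500 * (y * y) + 171/590 * (y * b) + 1154/435125 * (b * b)"
    unfolding y(2) by (simp add: power2_eq_square algebra_simps)
  also have "0 \<le> \<dots>"
    using y b by simp
  finally have "q * b + (q\<^sup>2 + 39/125 * b\<^sup>2) * (1/4) \<le> 39/125 * (q + b)\<^sup>2"
    by simp
  moreover have "(q\<^sup>2 + 39/125 * b\<^sup>2) * min (1/4) (43/250 * b / q) \<le> (q\<^sup>2 + 39/125 * b\<^sup>2) * (1/4)"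
    by (intro mult_left_mono) auto
  ultimately show ?thesis by linarith
next
  case False
  define t where "t = b / 59"
  define y where "y = q - 41 * t"
  have y: "0 \<le> y" "0 \<le> t" "q = 41 * t + y" "b = 59 * t"
    using False b by (auto simp: y_def t_def)
  have "39/125 * (q + b)\<^sup>2 * q - (q\<^sup>2 * b + 43/250 * b * (q\<^sup>2 + 39/125 * b\<^sup>2))
      = 39/125 * (y * y * y) + 1511/250 * (y * y * t) + 1033/125 * (y * t * t) + 10324271/15625 * (t * t * t)"
    unfolding y(3,4) by (simp add: power2_eq_square field_simps)
  also have "0 \<le> \<dots>"
    using y by simp
  finally have "q\<^sup>2 * b + 43/250 * b * (q\<^sup>2 + 39/125 * b\<^sup>2) \<le> 39/125 * (q + b)\<^sup>2 * q"
    by simp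
  then have "q * b + (q\<^sup>2 + 39/125 * b\<^sup>2) * (43/250 * b / q) \<le> 39/125 * (q + b)\<^sup>2"
    using q by (simp add: field_simps power2_eq_square)
  moreover have "(q\<^sup>2 + 39/125 * b\<^sup>2) * min (1/4) (43/250 * b / q) \<le> (q\<^sup>2 + 39/125 * b\<^sup>2) * (43/250 * b / q)"
    by (intro mult_left_mono) auto
  ultimately show ?thesis by linarith
qed

section \<open>Bipartite sets of pairwise joined edges\<close>

definition nbrs :: "('a \<Rightarrow> 'a \<Rightarrow> bool) \<Rightarrow> 'a set \<Rightarrow> 'a \<Rightarrow> 'a set" where
  "nbrs E V y = {u \<in> V. E y u}"

lemma card_nbrs_split:
  assumes "finite V"
  shows "card (nbrs E V y) = card (nbrs E (V - N) y) + card (nbrs E V y \<inter> N)"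
proof -
  have "nbrs E V y = nbrs E (V - N) y \<union> (nbrs E V y \<inter> N)" by (auto simp: nbrs_def)
  moreover have "card (nbrs E (V - N) y \<union> (nbrs E V y \<inter> N)) = card (nbrs E (V - N) y) + card (nbrs E V y \<inter> N)"
    using assms by (intro card_Un_disjoint) (auto simp: nbrs_def)
  ultimately show ?thesis by simp
qed

lemma sum_card_swap:
  assumes "finite A" "finite B"
  shows "(\<Sum>x\<in>A. card {y \<in> B. P x y}) = (\<Sum>y\<in>B. card {x \<in> A. P x y})"
proof -
  have "card (Sigma A (\<lambda>x. {y \<in> B. P x y})) = card ((Sigma A (\<lambda>x. {y \<in> B. P x y}))\<inverse>)"
    by simp
  also have "(Sigma A (\<lambda>x. {y \<in> B. P x y}))\<inverse> = Sigma B (\<lambda>y. {x \<in> A. P x y})"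
    by auto
  finally show ?thesis using assms by (simp add: card_SigmaI)
qed

lemma card_rel_fst:
  assumes "finite A" "H \<subseteq> A \<times> B" "finite B"
  shows "card H = (\<Sum>x\<in>A. card {v. (x, v) \<in> H})"
proof -
  have "H = Sigma A (\<lambda>x. {v. (x, v) \<in> H})" using assms by auto
  moreover have "card (Sigma A (\<lambda>x. {v. (x, v) \<in> H})) = (\<Sum>x\<in>A. card {v. (x, v) \<in> H})"
    using assms by (intro card_SigmaI) (auto intro: finite_subset[OF _ assms(3)])
  ultimately show ?thesis by simp
qed

lemma card_rel_snd:
  assumes "finite A" "H \<subseteq> A \<times> B" "finite B"
  shows "card H = (\<Sum>v\<in>B. card {x. (x, v) \<in> H})"
  using card_rel_fst[of B "H\<inverse>" A] assms by auto

text \<open>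
  Only the degrees of the endpoints of edges in \<open>H\<close> are limited, and only their sums. This is
  what makes the hypotheses hereditary: passing to the edges that are far from a vertex lowers the
  bound \<open>s\<close>, although it need not lower the degree of either endpoint in a controlled way. The graph
  \<open>E\<close> may also have edges inside \<open>U\<close> and inside \<open>A\<close>.
\<close>

locale strong_bipartite =
  fixes E :: "'a \<Rightarrow> 'a \<Rightarrow> bool" and V U A :: "'a set" and H :: "('a \<times> 'a) set" and s :: real
  assumes fin: "finite V" and sym: "E x y \<Longrightarrow> E y x"
    and H: "H \<subseteq> U \<times> A" "U \<subseteq> V" "A \<subseteq> V" "U \<inter> A = {}"
    and adj: "(x, v) \<in> H \<Longrightarrow> E x v"
    and link: "(x, v) \<in> H \<Longrightarrow> (x', v') \<in> H \<Longrightarrow> E x x' \<or> E v v' \<or> E x v' \<or> E x' v"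
    and deg: "(x, v) \<in> H \<Longrightarrow> real (card (nbrs E V x)) + real (card (nbrs E V v)) \<le> s"
begin

text \<open>
  Let \<open>N = N(v0)\<close>, \<open>X = {x. (x, v0) \<in> H}\<close> and \<open>\<beta> = s - q\<close>. The set \<open>H\<close> splits into the edges \<open>F\<close>
  that avoid \<open>N\<close>, the edges \<open>HX\<close> that start in \<open>X\<close>, and the other edges \<open>HT\<close> that meet \<open>N\<close>. Since the
  degrees of \<open>v0\<close> and of a vertex of \<open>X\<close> sum to at most \<open>s\<close>, and no vertex has \<open>H\<close>-degree above \<open>q\<close>,
  \<open>card HX + card HT\<close> is at most \<open>q * \<beta>\<close> minus the sum, over \<open>X\<close>, of the degrees outside
  \<open>H\<close>. Part of this sum can be located. A vertex \<open>v\<close> of \<open>A - N\<close> with \<open>f v\<close> edges in \<open>F\<close> has in \<open>X\<close> a number \<open>b v\<close> of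
  \<open>H\<close>-neighbours, \<open>n v\<close> of other neighbours, and \<open>c v\<close> of non-neighbours. If \<open>(y, v)\<close> is in \<open>F\<close>,
  then \<open>y\<close> is adjacent to the \<open>c v\<close> non-neighbours, because the edge \<open>(y, v)\<close> and the edges from \<open>v0\<close>
  to them have to be joined. So \<open>kap y\<close>, the number of neighbours of \<open>y\<close> in \<open>X\<close>, is at least \<open>c v\<close>. On the
  other hand the degree sum of \<open>y\<close> and \<open>v\<close> leaves room for few edges of \<open>H\<close> at \<open>y\<close>, so that every \<open>v\<close>
  can claim the share \<open>f v * c v / mu v\<close> of \<open>\<Sum>kap y\<close> as its own. Compared with \<open>q * \<beta>\<close>, the size of
  \<open>H\<close> grows by at most \<open>f v - n v - f v * c v / mu v\<close> for each \<open>v\<close>, and the sum of these terms is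
  estimated with \<open>gain_bound\<close> and \<open>\<Sum>(b v + f v) \<le> card HX + card F \<le> q\<^sup>2 + c * \<beta>\<^sup>2\<close>, where
  \<open>c = 39/125\<close>.
\<close>

lemma root_step:
  assumes v0: "v0 \<in> A" and q: "q = card {x. (x, v0) \<in> H}" "0 < q"
    and maxA: "\<And>v. v \<in> A \<Longrightarrow> card {x. (x, v) \<in> H} \<le> q"
    and maxU: "\<And>x. x \<in> U \<Longrightarrow> card {v. (x, v) \<in> H} \<le> q"
    and IH: "real (card {(x, v) \<in> H. x \<notin> nbrs E V v0 \<and> v \<notin> nbrs E V v0}) \<le> 39/125 * (s - q)\<^sup>2"
  shows "real (card H) \<le> 39/125 * s\<^sup>2"
proof -
  define N where "N = nbrs E V v0"
  define X where "X = {x. (x, v0) \<in> H}"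
  define F where "F = {(x, v) \<in> H. x \<notin> N \<and> v \<notin> N}"
  define HX where "HX = {(x, v) \<in> H. x \<in> X}"
  define HT where "HT = {(x, v) \<in> H. x \<notin> X \<and> (x \<in> N \<or> v \<in> N)}"
  define Z where "Z = A - N"
  define D where "D v = {x. (x, v) \<in> H \<and> x \<notin> N}" for v
  define DD where "DD = (\<Union>v\<in>Z. D v)"
  define b where "b v = card {x \<in> X. (x, v) \<in> H}" for v
  define n where "n v = card {x \<in> X. E x v \<and> (x, v) \<notin> H}" for v
  define c where "c v = card {x \<in> X. \<not> E x v}" for v
  define f where "f v = card (D v)" for v
  define kap where "kap y = card {x \<in> X. E y x}" for y
  define al where "al x = card {v. (x, v) \<in> H}" for x
  define beta where "beta = s - q"

  have finU: "finite U" and finA: "finite A"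
    using H fin by (auto intro: finite_subset)
  have finH: "finite H" using H(1) finU finA by (meson finite_SigmaI finite_subset)
  have finHr: "finite {v. (y, v) \<in> H}" for y
    using H(1) by (intro finite_subset[OF _ finA]) auto
  have finHl: "finite {x. (x, y) \<in> H}" for y
    using H(1) by (intro finite_subset[OF _ finU]) auto
  have XN: "X \<subseteq> N" using H adj sym by (auto simp: X_def N_def nbrs_def)
  have XU: "X \<subseteq> U" using H by (auto simp: X_def)
  have finX: "finite X" using XU finU by (rule finite_subset)
  have finN: "finite N" using fin by (simp add: N_def nbrs_def)
  have finZ: "finite Z" using finA by (simp add: Z_def)
  have cardX: "card X = q" by (simp add: X_def q)
  have DU: "D v \<subseteq> U - N" for v using H by (auto simp: D_def)
  have DDU: "DD \<subseteq> U - N" using DU by (auto simp: DD_def)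
  have finDD: "finite DD" using DDU finU by (meson finite_Diff finite_subset)
  have finD: "finite (D v)" for v using DU[of v] finU by (meson finite_Diff finite_subset)
  have IH': "real (card F) \<le> 39/125 * beta\<^sup>2"
    using IH by (simp add: F_def N_def beta_def)

  have split: "b v + n v + c v = q" if "v \<in> Z" for v
  proof -
    have "X = {x \<in> X. (x, v) \<in> H} \<union> {x \<in> X. E x v \<and> (x, v) \<notin> H} \<union> {x \<in> X. \<not> E x v}"
      by auto
    then have "card X = card ({x \<in> X. (x, v) \<in> H} \<union> {x \<in> X. E x v \<and> (x, v) \<notin> H} \<union> {x \<in> X. \<not> E x v})"
      by simp
    also have "\<dots> = card ({x \<in> X. (x, v) \<in> H} \<union> {x \<in> X. E x v \<and> (x, v) \<notin> H}) + c v"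
      unfolding c_def using finX adj by (intro card_Un_disjoint) auto
    also have "card ({x \<in> X. (x, v) \<in> H} \<union> {x \<in> X. E x v \<and> (x, v) \<notin> H}) = b v + n v"
      unfolding b_def n_def using finX by (intro card_Un_disjoint) auto
    finally show ?thesis using cardX by simp
  qed
  have bf: "b v + f v \<le> q" if "v \<in> Z" for v
  proof -
    have "b v + f v = card ({x \<in> X. (x, v) \<in> H} \<union> D v)"
      unfolding b_def f_def using finX finD XN by (intro card_Un_disjoint[symmetric]) (auto simp: D_def)
    also have "\<dots> \<le> card {x. (x, v) \<in> H}"
      using H(1) finU by (intro card_mono) (auto simp: D_def finHl)
    finally show ?thesis using maxA[of v] that by (simp add: Z_def)
  qed

  have cardF: "card F = (\<Sum>v\<in>Z. f v)"
  proof -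
    have "card F = (\<Sum>v\<in>Z. card {x. (x, v) \<in> F})"
      using H(1) finU finZ by (intro card_rel_snd[of U]) (auto simp: F_def Z_def)
    also have "\<dots> = (\<Sum>v\<in>Z. f v)"
      unfolding f_def by (intro sum.cong) (auto simp: F_def D_def Z_def)
    finally show ?thesis .
  qed
  have cardHX: "card HX = (\<Sum>x\<in>X. al x)"
  proof -
    have "card HX = (\<Sum>x\<in>X. card {v. (x, v) \<in> HX})"
      using H(1) finX finA by (intro card_rel_fst[of _ _ A]) (auto simp: HX_def)
    also have "\<dots> = (\<Sum>x\<in>X. al x)"
      unfolding al_def by (intro sum.cong) (auto simp: HX_def)
    finally show ?thesis .
  qed
  have HXq: "card HX \<le> q * q"
  proof -
    have "(\<Sum>x\<in>X. al x) \<le> (\<Sum>x\<in>X. q)"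
      using XU maxU by (intro sum_mono) (auto simp: al_def)
    then show ?thesis by (simp add: cardHX cardX)
  qed
  have bHX: "(\<Sum>v\<in>Z. b v) \<le> card HX"
  proof -
    have "(\<Sum>v\<in>Z. b v) = (\<Sum>x\<in>X. card {v \<in> Z. (x, v) \<in> H})"
      unfolding b_def using finX finZ by (rule sum_card_swap[symmetric])
    also have "\<dots> \<le> (\<Sum>x\<in>X. al x)"
      unfolding al_def using H(1) finA
      by (intro sum_mono card_mono) (auto simp: finHr)
    finally show ?thesis by (simp add: cardHX)
  qed
  have cardHT: "card HT \<le> q * (card N - q)"
  proof -
    have "HT \<subseteq> (\<Union>y\<in>N - X. {e \<in> H. fst e = y \<or> snd e = y})"
      using XU H by (fastforce simp: HT_def)
    then have "card HT \<le> card (\<Union>y\<in>N - X. {e \<in> H. fst e = y \<or> snd e = y})"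
      using finN finH by (intro card_mono) auto
    also have "\<dots> \<le> (\<Sum>y\<in>N - X. card {e \<in> H. fst e = y \<or> snd e = y})"
      using finN by (intro card_UN_le) auto
    also have "\<dots> \<le> (\<Sum>y\<in>N - X. q)"
    proof (intro sum_mono)
      fix y
      consider "y \<in> U" | "y \<in> A" | "y \<notin> U" "y \<notin> A" by blast
      then show "card {e \<in> H. fst e = y \<or> snd e = y} \<le> q"
      proof cases
        case 1
        have "{e \<in> H. fst e = y \<or> snd e = y} = Pair y ` {v. (y, v) \<in> H}"
          using H 1 by force
        then have "card {e \<in> H. fst e = y \<or> snd e = y} \<le> card {v. (y, v) \<in> H}"
          using card_image_le[OF finHr] by metis
        then show ?thesis using maxU[OF 1] by simp
      next
        case 2
        have "{e \<in> H. fst e = y \<or> snd e = y} = (\<lambda>x. (x, y)) ` {x. (x, y) \<in> H}"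
          using H 2 by force
        then have "card {e \<in> H. fst e = y \<or> snd e = y} \<le> card {x. (x, y) \<in> H}"
          using card_image_le[OF finHl] by metis
        then show ?thesis using maxA[OF 2] by simp
      next
        case 3
        then have "{e \<in> H. fst e = y \<or> snd e = y} = {}" using H(1) by force
        then show ?thesis by (simp only: card.empty)
      qed
    qed
    also have "\<dots> = q * (card N - q)"
      using XN finX cardX by (simp add: card_Diff_subset mult.commute)
    finally show ?thesis .
  qed
  have qN: "q \<le> card N" using card_mono[OF finN XN] cardX by simp
  have cardH: "card H = card HX + card HT + card F"
  proof -
    have "H = (HX \<union> HT) \<union> F" using XN by (auto simp: HX_def HT_def F_def)
    moreover have "card ((HX \<union> HT) \<union> F) = card (HX \<union> HT) + card F"
      using finH XN by (intro card_Un_disjoint) (auto simp: HX_def HT_def F_def elim: finite_subset[rotated])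
    moreover have "card (HX \<union> HT) = card HX + card HT"
      using finH by (intro card_Un_disjoint) (auto simp: HX_def HT_def elim: finite_subset[rotated])
    ultimately show ?thesis by simp
  qed

  have degX: "al x + card {v \<in> Z. E x v \<and> (x, v) \<notin> H} + card {y \<in> DD. E y x} \<le> s - card N" if "x \<in> X" for x
  proof -
    have "al x + card {v \<in> Z. E x v \<and> (x, v) \<notin> H} + card {y \<in> DD. E y x} =
        card ({v. (x, v) \<in> H} \<union> {v \<in> Z. E x v \<and> (x, v) \<notin> H}) + card {y \<in> DD. E y x}"
      unfolding al_def using finZ H(1) by (subst card_Un_disjoint) (auto simp: finHr)
    also have "\<dots> = card (({v. (x, v) \<in> H} \<union> {v \<in> Z. E x v \<and> (x, v) \<notin> H}) \<union> {y \<in> DD. E y x})"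
    proof (intro card_Un_disjoint[symmetric])
      show "({v. (x, v) \<in> H} \<union> {v \<in> Z. E x v \<and> (x, v) \<notin> H}) \<inter> {y \<in> DD. E y x} = {}"
        using H DDU by (auto simp: Z_def)
    qed (use finZ finDD finHr in simp_all)
    also have "\<dots> \<le> card (nbrs E V x)"
      using fin adj H DDU sym by (intro card_mono) (auto simp: nbrs_def Z_def)
    finally show ?thesis
      using deg[of x v0] that by (simp add: X_def N_def)
  qed
  have sumX: "real (card HX) + (\<Sum>v\<in>Z. real (n v)) + (\<Sum>y\<in>DD. real (kap y)) \<le> q * (s - card N)"
  proof -
    have "(\<Sum>v\<in>Z. n v) = (\<Sum>x\<in>X. card {v \<in> Z. E x v \<and> (x, v) \<notin> H})"
      unfolding n_def using finX finZ by (rule sum_card_swap[symmetric])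
    moreover have "(\<Sum>y\<in>DD. kap y) = (\<Sum>x\<in>X. card {y \<in> DD. E y x})"
      unfolding kap_def using finX finDD by (intro sum_card_swap) auto
    ultimately have "real (card HX) + (\<Sum>v\<in>Z. real (n v)) + (\<Sum>y\<in>DD. real (kap y))
       = (\<Sum>x\<in>X. real (al x + card {v \<in> Z. E x v \<and> (x, v) \<notin> H} + card {y \<in> DD. E y x}))"
      unfolding cardHX by (simp add: sum.distrib flip: of_nat_sum)
    also have "\<dots> \<le> (\<Sum>x\<in>X. s - card N)"
      using degX by (intro sum_mono) auto
    finally show ?thesis by (simp add: cardX)
  qed

  have ck: "c v \<le> kap y" if "v \<in> Z" "y \<in> D v" for v y
    unfolding c_def kap_def
  proof (intro card_mono)
    show "{x \<in> X. \<not> E x v} \<subseteq> {x \<in> X. E y x}"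
    proof safe
      fix x assume x: "x \<in> X" "\<not> E x v"
      have "\<not> E v0 v" "\<not> E y v0"
        using that H sym by (auto simp: Z_def D_def N_def nbrs_def)
      then show "E y x"
        using link[of x v0 y v] x that sym by (auto simp: X_def D_def)
    qed
  qed (use finX in auto)
  have degD: "real (al y) + kap y + f v + b v + n v \<le> s" if "v \<in> Z" "y \<in> D v" for v y
  proof -
    have "al y + kap y = card ({v. (y, v) \<in> H} \<union> {x \<in> X. E y x})"
      unfolding al_def kap_def using finX H XU
      by (intro card_Un_disjoint[symmetric]) (auto simp: finHr)
    also have "\<dots> \<le> card (nbrs E V y)"
      using fin adj H XU by (intro card_mono) (auto simp: nbrs_def)
    finally have 1: "al y + kap y \<le> card (nbrs E V y)" .
    have "f v + b v + n v = card (D v \<union> {x \<in> X. (x, v) \<in> H}) + n v"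
      unfolding f_def b_def using finX finD XN by (subst card_Un_disjoint) (auto simp: D_def)
    also have "\<dots> = card ((D v \<union> {x \<in> X. (x, v) \<in> H}) \<union> {x \<in> X. E x v \<and> (x, v) \<notin> H})"
      unfolding n_def using finX finD XN by (intro card_Un_disjoint[symmetric]) (auto simp: D_def)
    also have "\<dots> \<le> card (nbrs E V v)"
      using fin adj H XU sym DU[of v] by (intro card_mono) (auto simp: nbrs_def D_def)
    finally show ?thesis using 1 deg[of y v] that by (auto simp: D_def)
  qed
  have alq: "1 \<le> al y" "al y \<le> q" if "v \<in> Z" "y \<in> D v" for v y
  proof -
    have "v \<in> {v. (y, v) \<in> H}" "finite {v. (y, v) \<in> H}"
      using that H(1) by (auto simp: D_def finHr)
    then show "1 \<le> al y" unfolding al_def by (metis One_nat_def Suc_leI card_gt_0_iff empty_iff)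
    show "al y \<le> q" using maxU[of y] DU that by (auto simp: al_def)
  qed
  have fbeta: "real (al y) + f v \<le> beta" if "v \<in> Z" "y \<in> D v" for v y
    using degD[OF that] ck[OF that] split[OF that(1)] by (simp add: beta_def)

  define mu where "mu v = min (real q) (beta - f v)" for v
  have mupos: "0 < mu v" if "v \<in> Z" "y \<in> D v" for v y
    using fbeta[OF that] alq[OF that] q(2) by (simp add: mu_def)
  \<comment> \<open>Each of the at most \<open>al y\<close> vertices \<open>v\<close> joined to \<open>y\<close> gets the part \<open>c v / mu v\<close> of \<open>kap y\<close>. If \<open>mu v = beta - f v\<close>,
    this uses that a larger \<open>kap y\<close> also makes \<open>al y\<close> smaller.\<close>
  have share: "c v / mu v \<le> kap y / al y" if "v \<in> Z" "y \<in> D v" for v y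
  proof -
    have "c v * real (al y) \<le> kap y * mu v"
    proof (cases "real q \<le> beta - f v")
      case True
      then show ?thesis using ck[OF that] alq[OF that] by (auto simp: mu_def intro!: mult_mono)
    next
      case False
      have "0 \<le> (real (kap y) - c v) * (beta - f v + c v)"
        using ck[OF that] fbeta[OF that] by (intro mult_nonneg_nonneg) auto
      moreover have "c v * real (al y) \<le> c v * (beta - f v + c v - kap y)"
        using degD[OF that] split[OF that(1)] by (intro mult_left_mono) (auto simp: beta_def)
      ultimately show ?thesis using False by (simp add: mu_def algebra_simps)
    qed
    then show ?thesis using mupos[OF that] alq[OF that] by (simp add: field_simps)
  qed
  have sumkap: "(\<Sum>v\<in>Z. f v * (c v / mu v)) \<le> (\<Sum>y\<in>DD. real (kap y))"
  proof -
    have "(\<Sum>v\<in>Z. f v * (c v / mu v)) = (\<Sum>v\<in>Z. \<Sum>y\<in>{y \<in> DD. y \<in> D v}. c v / mu v)"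
    proof (intro sum.cong refl)
      fix v assume "v \<in> Z"
      then have "{y \<in> DD. y \<in> D v} = D v" by (auto simp: DD_def)
      then show "f v * (c v / mu v) = (\<Sum>y\<in>{y \<in> DD. y \<in> D v}. c v / mu v)"
        by (simp add: f_def)
    qed
    also have "\<dots> = (\<Sum>y\<in>DD. \<Sum>v\<in>{v \<in> Z. y \<in> D v}. c v / mu v)"
      by (rule sum.swap_restrict[OF finZ finDD])
    also have "\<dots> \<le> (\<Sum>y\<in>DD. real (kap y))"
    proof (intro sum_mono)
      fix y assume "y \<in> DD"
      then obtain v1 where v1: "v1 \<in> Z" "y \<in> D v1" by (auto simp: DD_def)
      have "(\<Sum>v\<in>{v \<in> Z. y \<in> D v}. c v / mu v) \<le> (\<Sum>v\<in>{v \<in> Z. y \<in> D v}. kap y / al y)"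
        using share by (intro sum_mono) auto
      also have "\<dots> = card {v \<in> Z. y \<in> D v} * (kap y / al y)" by simp
      also have "\<dots> \<le> al y * (kap y / al y)"
      proof (intro mult_right_mono)
        have "card {v \<in> Z. y \<in> D v} \<le> al y" unfolding al_def using H(1)
          by (intro card_mono) (auto simp: D_def finHr)
        then show "real (card {v \<in> Z. y \<in> D v}) \<le> al y" by simp
      qed auto
      also have "\<dots> = kap y" using alq[OF v1] by simp
      finally show "(\<Sum>v\<in>{v \<in> Z. y \<in> D v}. c v / mu v) \<le> real (kap y)" .
    qed
    finally show ?thesis .
  qed

  have beta0: "0 \<le> beta"
  proof -
    obtain x where x: "x \<in> X" using cardX q(2) by fastforce
    have "real q \<le> s"
      using deg[of x v0] x qN by (simp add: X_def N_def)
    then show ?thesis by (simp add: beta_def)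
  qed

  let ?r = "min (1/4) (43/250 * beta / q)"
  have gain: "real (f v) - real (n v) - f v * (c v / mu v) \<le> (b v + f v) * ?r" if v: "v \<in> Z" for v
  proof (cases "f v = 0")
    case True
    then show ?thesis using beta0 by (auto intro!: order.trans[OF _ mult_nonneg_nonneg])
  next
    case False
    then obtain y where y: "y \<in> D v" unfolding f_def by fastforce
    have c: "real (c v) = real q - real (b v + f v) + real (f v) - real (n v)"
      using split[OF v, symmetric] by simp
    show ?thesis
      using gain_bound[of "f v" "b v + f v" q "n v" beta] bf[OF v] split[OF v] q(2) fbeta[OF v y] alq[OF v y]
      unfolding mu_def c by simp
  qed

  have "real (card H) = card HX + card HT + card F" using cardH by simp
  also have "\<dots> \<le> q * (s - card N) - (\<Sum>v\<in>Z. real (n v)) - (\<Sum>y\<in>DD. real (kap y)) + q * (card N - real q) + card F"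
  proof -
    have "real (card HT) \<le> real (q * (card N - q))" using cardHT by (simp only: of_nat_le_iff)
    also have "\<dots> = q * (card N - real q)" using qN by (simp add: of_nat_diff)
    finally show ?thesis using sumX by simp
  qed
  also have "\<dots> \<le> q * beta + (\<Sum>v\<in>Z. real (f v) - real (n v) - f v * (c v / mu v))"
    using sumkap by (simp add: cardF sum_subtractf sum.distrib beta_def algebra_simps)
  also have "(\<Sum>v\<in>Z. real (f v) - real (n v) - f v * (c v / mu v)) \<le> (\<Sum>v\<in>Z. (b v + f v) * ?r)"
    using gain by (intro sum_mono)
  also have "(\<Sum>v\<in>Z. (b v + f v) * ?r) = ((\<Sum>v\<in>Z. b v) + (\<Sum>v\<in>Z. f v)) * ?r"
    by (simp add: sum_distrib_right[symmetric] sum.distrib)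
  also have "\<dots> \<le> ((real q)\<^sup>2 + 39/125 * beta\<^sup>2) * ?r"
  proof (intro mult_right_mono)
    have "real (\<Sum>v\<in>Z. b v) \<le> real (q * q)" using bHX HXq by (simp only: of_nat_le_iff)
    moreover have "real (\<Sum>v\<in>Z. f v) \<le> 39/125 * beta\<^sup>2" using IH' cardF by simp
    ultimately show "real ((\<Sum>v\<in>Z. b v) + (\<Sum>v\<in>Z. f v)) \<le> (real q)\<^sup>2 + 39/125 * beta\<^sup>2"
      by (simp add: power2_eq_square)
  qed (use beta0 in auto)
  also have "q * beta + ((real q)\<^sup>2 + 39/125 * beta\<^sup>2) * ?r \<le> 39/125 * (q + beta)\<^sup>2"
    using final_bound[of q beta] q(2) beta0 by simp
  finally show ?thesis by (simp add: beta_def)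
qed

text \<open>The hypotheses are symmetric in the two sides, so the vertex of largest degree may be assumed to lie in \<open>A\<close>.\<close>

lemma converse: "strong_bipartite E V A U (H\<inverse>) s"
proof
  show "E x x' \<or> E v v' \<or> E x v' \<or> E x' v" if "(x, v) \<in> H\<inverse>" "(x', v') \<in> H\<inverse>" for x v x' v'
    using link[of v x v' x'] sym that by auto
  show "E x v" if "(x, v) \<in> H\<inverse>" for x v
    using adj sym that by auto
  show "real (card (nbrs E V x)) + real (card (nbrs E V v)) \<le> s" if "(x, v) \<in> H\<inverse>" for x v
    using deg[of v x] that by simp
qed (use fin sym H in auto)

text \<open>
  An edge of \<open>H\<close> without endpoint in \<open>N(v0)\<close> can be joined to an edge \<open>(x, v0)\<close> of \<open>H\<close> only at \<open>x\<close>. So its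
  endpoints lose together at least as many neighbours as \<open>v0\<close> has in \<open>H\<close> when \<open>N(v0)\<close> is removed.
\<close>

lemma far_edges:
  assumes v0: "v0 \<in> A"
  defines "N \<equiv> nbrs E V v0"
  shows "strong_bipartite E (V - N) (U - N) (A - N) {(x, v) \<in> H. x \<notin> N \<and> v \<notin> N}
           (s - real (card {x. (x, v0) \<in> H}))"
proof
  fix x v assume xv: "(x, v) \<in> {(x, v) \<in> H. x \<notin> N \<and> v \<notin> N}"
  let ?X = "{x. (x, v0) \<in> H}"
  have finN: "finite (nbrs E V y)" for y using fin by (simp add: nbrs_def)
  have split: "card (nbrs E V y) = card (nbrs E (V - N) y) + card (nbrs E V y \<inter> N)" for y
    using fin by (rule card_nbrs_split)
  have "?X \<subseteq> (nbrs E V x \<inter> N) \<union> (nbrs E V v \<inter> N)"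
  proof
    fix y assume y: "y \<in> ?X"
    have "\<not> E v0 v" "\<not> E x v0" "y \<in> V" "E v0 y"
      using xv y H sym adj by (auto simp: N_def nbrs_def)
    then show "y \<in> (nbrs E V x \<inter> N) \<union> (nbrs E V v \<inter> N)"
      using link[of y v0 x v] xv y sym by (auto simp: N_def nbrs_def)
  qed
  then have "card ?X \<le> card ((nbrs E V x \<inter> N) \<union> (nbrs E V v \<inter> N))"
    using finN by (intro card_mono) auto
  also have "\<dots> \<le> card (nbrs E V x \<inter> N) + card (nbrs E V v \<inter> N)" by (rule card_Un_le)
  finally show "real (card (nbrs E (V - N) x)) + real (card (nbrs E (V - N) v)) \<le> s - real (card ?X)"
    using deg[of x v] xv split[of x] split[of v] by auto
qed (use fin sym H adj link in auto)

end

theorem strong_bipartite_card_le: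
  assumes "strong_bipartite E V U A H s"
  shows "real (card H) \<le> 39/125 * s\<^sup>2"
  using assms
proof (induction "card V" arbitrary: V U A H s rule: less_induct)
  case less
  have main: "real (card H) \<le> 39/125 * s\<^sup>2"
    if B: "strong_bipartite E V U A H s" and v0: "v0 \<in> A" and pos: "0 < card {x. (x, v0) \<in> H}"
      and maxA: "\<And>v. v \<in> A \<Longrightarrow> card {x. (x, v) \<in> H} \<le> card {x. (x, v0) \<in> H}"
      and maxU: "\<And>x. x \<in> U \<Longrightarrow> card {v. (x, v) \<in> H} \<le> card {x. (x, v0) \<in> H}"
    for U A H v0
  proof -
    interpret strong_bipartite E V U A H s by fact
    let ?N = "nbrs E V v0"
    obtain x where "(x, v0) \<in> H" using pos by (auto simp: card_gt_0_iff)
    then have "x \<in> ?N \<inter> V" using H adj sym by (auto simp: nbrs_def)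
    then have "card (V - ?N) < card V" using fin by (intro psubset_card_mono) auto
    from less.hyps[OF this far_edges[OF v0]]
    show ?thesis by (intro root_step[OF v0 refl pos maxA maxU])
  qed
  interpret strong_bipartite E V U A H s by fact
  show ?case
  proof (cases "H = {}")
    case False
    define g where "g y = (if y \<in> U then card {v. (y, v) \<in> H} else card {x. (x, y) \<in> H})" for y
    have finUA: "finite (U \<union> A)" using H fin by (auto intro: finite_subset)
    obtain x1 v1 where xv: "(x1, v1) \<in> H" using False by auto
    then have ne: "U \<union> A \<noteq> {}" using H by auto
    obtain y where y: "y \<in> U \<union> A" "\<And>z. z \<in> U \<union> A \<Longrightarrow> g z \<le> g y"
    proof -
      have "Max (g ` (U \<union> A)) \<in> g ` (U \<union> A)" using finUA ne by (intro Max_in) auto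
      then obtain y where "y \<in> U \<union> A" "g y = Max (g ` (U \<union> A))" by (metis imageE)
      then show ?thesis using finUA by (intro that[of y]) auto
    qed
    have gU: "g z = card {v. (z, v) \<in> H}" if "z \<in> U" for z using that by (simp add: g_def)
    have gA: "g z = card {x. (x, z) \<in> H}" if "z \<in> A" for z using that H by (auto simp: g_def)
    have "finite {v. (x1, v) \<in> H}"
      using H(1) by (intro finite_subset[OF _ finUA]) auto
    then have "0 < card {v. (x1, v) \<in> H}" using xv by (subst card_gt_0_iff) auto
    moreover have "x1 \<in> U" using xv H(1) by auto
    ultimately have pos: "0 < g y" using y(2)[of x1] gU[of x1] by auto
    show ?thesis
    proof (cases "y \<in> A")
      case True
      show ?thesis
      proof (rule main[OF less.prems True])
        show "0 < card {x. (x, y) \<in> H}" using pos by (simp add: gA[OF True])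
      next
        fix v assume "v \<in> A"
        then show "card {x. (x, v) \<in> H} \<le> card {x. (x, y) \<in> H}"
          using y(2)[of v] by (simp add: gA True)
      next
        fix x assume "x \<in> U"
        then show "card {v. (x, v) \<in> H} \<le> card {x. (x, y) \<in> H}"
          using y(2)[of x] by (simp add: gA gU True)
      qed
    next
      case False
      then have yU: "y \<in> U" using y(1) by simp
      have "real (card (H\<inverse>)) \<le> 39/125 * s\<^sup>2"
      proof (rule main[OF converse yU])
        show "0 < card {x. (x, y) \<in> H\<inverse>}" using pos by (simp add: gU[OF yU])
      next
        fix v assume "v \<in> U"
        then show "card {x. (x, v) \<in> H\<inverse>} \<le> card {x. (x, y) \<in> H\<inverse>}"
          using y(2)[of v] by (simp add: gU yU)
      next
        fix x assume "x \<in> A"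
        then show "card {v. (x, v) \<in> H\<inverse>} \<le> card {x. (x, y) \<in> H\<inverse>}"
          using y(2)[of x] by (simp add: gA gU yU)
      qed
      then show ?thesis by simp
    qed
  qed simp
qed

section \<open>Sets of pairwise joined edges in a graph of bounded degree\<close>

text \<open>An edge is represented here by its two arcs, so that sums over the edges at a vertex are sums over rows of \<open>P\<close>.\<close>

locale strong_arcs =
  fixes E :: "'a \<Rightarrow> 'a \<Rightarrow> bool" and V :: "'a set" and P :: "('a \<times> 'a) set" and d :: nat
  assumes fin: "finite V" and sym: "E x y \<Longrightarrow> E y x"
    and P: "P \<subseteq> V \<times> V" and symP: "(x, y) \<in> P \<Longrightarrow> (y, x) \<in> P"
    and adj: "(x, y) \<in> P \<Longrightarrow> E x y"
    and link: "(x, y) \<in> P \<Longrightarrow> (x', y') \<in> P \<Longrightarrow> E x x' \<or> E y y' \<or> E x y' \<or> E x' y"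
    and deg: "x \<in> V \<Longrightarrow> card (nbrs E V x) \<le> d"
begin

definition hdeg :: "'a \<Rightarrow> nat" where "hdeg x = card {y. (x, y) \<in> P}"

lemma finP: "finite P"
  using fin P by (meson finite_SigmaI finite_subset)

lemma fin_row: "finite {y. (x, y) \<in> P}"
  using P by (intro finite_subset[OF _ fin]) auto

lemma fin_nbrs: "finite (nbrs E V x)"
  using fin by (simp add: nbrs_def)

lemma hdeg_le: "x \<in> V \<Longrightarrow> hdeg x \<le> d"
  using card_mono[OF fin_nbrs, of "{y. (x, y) \<in> P}" x] deg[of x] P adj
  by (fastforce simp: hdeg_def nbrs_def)

text \<open>
  These edges form a bipartite set in the graph without \<open>N(w)\<close>. There the degree sum of their endpoints
  has dropped by at least \<open>hdeg w\<close>, because an arc \<open>(w, y)\<close> of \<open>P\<close> can be joined to them only at \<open>y\<close>.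
\<close>

lemma edges_beyond_base:
  assumes zw: "(z, w) \<in> P"
  defines "A \<equiv> nbrs E V z" and "B \<equiv> nbrs E V w"
  shows "real (card {(x, v) \<in> P. x \<in> V - (A \<union> B) \<and> v \<in> A - B}) \<le> 39/125 * (2 * real d - hdeg w)\<^sup>2"
proof (rule strong_bipartite_card_le)
  let ?H = "{(x, v) \<in> P. x \<in> V - (A \<union> B) \<and> v \<in> A - B}"
  show "strong_bipartite E (V - B) (V - (A \<union> B)) (A - B) ?H (2 * real d - hdeg w)"
  proof
    fix x v assume xv: "(x, v) \<in> ?H"
    have "{y. (w, y) \<in> P} \<subseteq> (nbrs E V x \<inter> B) \<union> (nbrs E V v \<inter> B)"
    proof
      fix y assume y: "y \<in> {y. (w, y) \<in> P}"
      have "y \<in> B" "y \<in> V" using y P adj by (auto simp: B_def nbrs_def)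
      moreover have "\<not> E w x" "\<not> E w v" using xv P by (auto simp: B_def nbrs_def)
      ultimately show "y \<in> (nbrs E V x \<inter> B) \<union> (nbrs E V v \<inter> B)"
        using link[of w y x v] xv y sym by (auto simp: nbrs_def)
    qed
    then have "hdeg w \<le> card ((nbrs E V x \<inter> B) \<union> (nbrs E V v \<inter> B))"
      unfolding hdeg_def using fin_nbrs by (intro card_mono) auto
    also have "\<dots> \<le> card (nbrs E V x \<inter> B) + card (nbrs E V v \<inter> B)" by (rule card_Un_le)
    finally show "real (card (nbrs E (V - B) x)) + real (card (nbrs E (V - B) v)) \<le> 2 * real d - hdeg w"
      using card_nbrs_split[OF fin, of E x B] card_nbrs_split[OF fin, of E v B] deg[of x] deg[of v] xv P
      by auto
  qed (use fin sym P adj link in \<open>auto simp: A_def B_def nbrs_def\<close>)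
qed

definition nbr_sum :: "'a \<Rightarrow> nat" where "nbr_sum x = (\<Sum>y\<in>nbrs E V x. hdeg y)"

lemma card_rows:
  assumes "A \<subseteq> V"
  shows "card {(x, y) \<in> P. x \<in> A} = (\<Sum>x\<in>A. hdeg x)"
proof -
  have "card {(x, y) \<in> P. x \<in> A} = (\<Sum>x\<in>A. card {y. (x, y) \<in> {(x, y) \<in> P. x \<in> A}})"
    using assms fin P by (intro card_rel_fst[of _ _ V]) (auto intro: finite_subset)
  also have "\<dots> = (\<Sum>x\<in>A. hdeg x)" unfolding hdeg_def by (intro sum.cong) auto
  finally show ?thesis .
qed

lemma card_P: "card P = (\<Sum>x\<in>V. hdeg x)"
proof -
  have "{(x, y) \<in> P. x \<in> V} = P" using P by auto
  then show ?thesis using card_rows[of V] by simp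
qed

text \<open>
  An arc from outside the two neighbourhoods into \<open>N(z) \<inter> N(w)\<close> is missed by both neighbour sums, but
  its reverse is counted by both. The other arcs that both sums miss belong to the two bipartite sets
  of \<open>edges_beyond_base\<close>.
\<close>

lemma base_edge:
  assumes zw: "(z, w) \<in> P"
  shows "real (card P) \<le> (nbr_sum z + 39/125 * (2 * real d - hdeg z)\<^sup>2) + (nbr_sum w + 39/125 * (2 * real d - hdeg w)\<^sup>2)"
proof -
  define A where "A = nbrs E V z"
  define B where "B = nbrs E V w"
  define PA where "PA = {(x, y) \<in> P. x \<in> A}"
  define PB where "PB = {(x, y) \<in> P. x \<in> B}"
  define HA where "HA = {(x, v) \<in> P. x \<in> V - (A \<union> B) \<and> v \<in> A - B}"
  define HB where "HB = {(x, v) \<in> P. x \<in> V - (A \<union> B) \<and> v \<in> B - A}"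
  define PU where "PU = {(x, v) \<in> P. x \<in> V - (A \<union> B) \<and> v \<in> A \<inter> B}"
  have cover: "P \<subseteq> (PA \<union> PB) \<union> (HA \<union> (HB \<union> PU))"
  proof
    fix e assume "e \<in> P"
    then obtain x y where e: "e = (x, y)" and xy: "(x, y) \<in> P" by (cases e) auto
    have "E z x \<or> E w y \<or> E z y \<or> E x w" using link[OF zw xy] .
    then have "x \<in> A \<union> B \<or> y \<in> A \<union> B"
      using xy P sym by (auto simp: A_def B_def nbrs_def)
    then show "e \<in> (PA \<union> PB) \<union> (HA \<union> (HB \<union> PU))"
      using xy P by (auto simp: e PA_def PB_def HA_def HB_def PU_def)
  qed
  have fins: "finite PA" "finite PB" "finite HA" "finite HB" "finite PU"
    unfolding PA_def PB_def HA_def HB_def PU_def using finP by (auto elim: finite_subset[rotated])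
  have "card PU = card (PU\<inverse>)" by simp
  also have "\<dots> \<le> card (PA \<inter> PB)"
    using fins symP by (intro card_mono) (auto simp: PU_def PA_def PB_def)
  finally have PU: "card PU \<le> card (PA \<inter> PB)" .
  have "card P \<le> card ((PA \<union> PB) \<union> (HA \<union> (HB \<union> PU)))"
    using cover fins by (intro card_mono) auto
  also have "\<dots> \<le> card (PA \<union> PB) + (card HA + (card HB + card PU))"
    by (intro order.trans[OF card_Un_le] add_mono order.refl)
  also have "\<dots> \<le> card PA + card PB + card HA + card HB"
    using card_Un_Int[OF fins(1,2)] PU by simp
  finally have "card P \<le> card PA + card PB + card HA + card HB" .
  moreover have "card PA = nbr_sum z"
    unfolding PA_def nbr_sum_def A_def by (rule card_rows) (auto simp: nbrs_def)
  moreover have "card PB = nbr_sum w"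
    unfolding PB_def nbr_sum_def B_def by (rule card_rows) (auto simp: nbrs_def)
  moreover have "real (card HA) \<le> 39/125 * (2 * real d - hdeg w)\<^sup>2"
    using edges_beyond_base[OF zw] by (simp add: HA_def A_def B_def)
  moreover have "real (card HB) \<le> 39/125 * (2 * real d - hdeg z)\<^sup>2"
    using edges_beyond_base[OF symP[OF zw]] by (simp add: HB_def A_def B_def Un_commute)
  ultimately show ?thesis by linarith
qed

text \<open>
  The left side is the sum of \<open>hdeg z * hdeg y\<close> over all arcs \<open>(z, y)\<close> of the graph, and each product
  is at most the mean of the two squares.
\<close>

lemma sum_hdeg_nbr_sum: "(\<Sum>z\<in>V. hdeg z * nbr_sum z) \<le> (\<Sum>z\<in>V. d * (hdeg z)\<^sup>2)"
proof -
  have "2 * (\<Sum>z\<in>V. hdeg z * nbr_sum z) = (\<Sum>z\<in>V. \<Sum>y\<in>nbrs E V z. 2 * (hdeg z * hdeg y))"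
    by (simp add: nbr_sum_def sum_distrib_left)
  also have "\<dots> \<le> (\<Sum>z\<in>V. \<Sum>y\<in>nbrs E V z. (hdeg z)\<^sup>2 + (hdeg y)\<^sup>2)"
  proof (intro sum_mono)
    fix z y
    have "2 * real (hdeg z) * real (hdeg y) \<le> (real (hdeg z))\<^sup>2 + (real (hdeg y))\<^sup>2"
      by (rule sum_squares_bound)
    then have "real (2 * (hdeg z * hdeg y)) \<le> real ((hdeg z)\<^sup>2 + (hdeg y)\<^sup>2)" by simp
    then show "2 * (hdeg z * hdeg y) \<le> (hdeg z)\<^sup>2 + (hdeg y)\<^sup>2" by (simp only: of_nat_le_iff)
  qed
  also have "\<dots> = (\<Sum>z\<in>V. \<Sum>y\<in>nbrs E V z. (hdeg z)\<^sup>2) + (\<Sum>z\<in>V. \<Sum>y\<in>nbrs E V z. (hdeg y)\<^sup>2)"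
    by (simp add: sum.distrib)
  also have "(\<Sum>z\<in>V. \<Sum>y\<in>nbrs E V z. (hdeg y)\<^sup>2) = (\<Sum>y\<in>V. \<Sum>z\<in>{z \<in> V. E z y}. (hdeg y)\<^sup>2)"
    unfolding nbrs_def by (rule sum.swap_restrict[OF fin fin])
  also have "\<dots> = (\<Sum>z\<in>V. \<Sum>y\<in>nbrs E V z. (hdeg z)\<^sup>2)"
    using sym unfolding nbrs_def by (intro sum.cong) auto
  also have "(\<Sum>z\<in>V. \<Sum>y\<in>nbrs E V z. (hdeg z)\<^sup>2) + (\<Sum>z\<in>V. \<Sum>y\<in>nbrs E V z. (hdeg z)\<^sup>2)
      = 2 * (\<Sum>z\<in>V. card (nbrs E V z) * (hdeg z)\<^sup>2)"
    by simp
  also have "\<dots> \<le> 2 * (\<Sum>z\<in>V. d * (hdeg z)\<^sup>2)"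
    using deg by (intro mult_left_mono sum_mono mult_right_mono) auto
  finally show ?thesis by simp
qed

text \<open>
  Summing \<open>base_edge\<close> over all arcs of \<open>P\<close> weights each vertex by its degree \<open>h\<close> in \<open>P\<close>. The
  resulting function \<open>d * h + c * (2 * d - h)\<^sup>2\<close>, with \<open>c = 39/125\<close>, is largest at \<open>h = d\<close>,
  as \<open>3 * c < 1\<close>.
\<close>

theorem card_arcs_le: "real (card P) \<le> 2 * (164/125 * (real d)\<^sup>2)"
proof -
  define T where "T x = nbr_sum x + 39/125 * (2 * real d - hdeg x)\<^sup>2" for x
  have Pfst: "(\<Sum>e\<in>P. T (fst e)) = (\<Sum>z\<in>V. hdeg z * T z)"
  proof -
    have "(\<Sum>z\<in>V. hdeg z * T z) = (\<Sum>z\<in>V. \<Sum>w\<in>{w. (z, w) \<in> P}. T z)"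
      by (simp add: hdeg_def)
    also have "\<dots> = (\<Sum>(z, w)\<in>Sigma V (\<lambda>z. {w. (z, w) \<in> P}). T z)"
      using fin fin_row by (intro sum.Sigma) auto
    also have "Sigma V (\<lambda>z. {w. (z, w) \<in> P}) = P" using P by auto
    finally show ?thesis by (simp add: split_def)
  qed
  have Psnd: "(\<Sum>e\<in>P. T (snd e)) = (\<Sum>e\<in>P. T (fst e))"
    using symP by (intro sum.reindex_bij_witness[of _ prod.swap prod.swap]) auto
  have "(real (card P))\<^sup>2 = (\<Sum>e\<in>P. real (card P))"
    by (simp add: power2_eq_square)
  also have "\<dots> \<le> (\<Sum>e\<in>P. T (fst e) + T (snd e))"
    using base_edge by (intro sum_mono) (auto simp: T_def)
  also have "\<dots> = 2 * (\<Sum>z\<in>V. hdeg z * T z)"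
    by (simp add: sum.distrib Psnd Pfst)
  also have "(\<Sum>z\<in>V. hdeg z * T z) = real (\<Sum>z\<in>V. hdeg z * nbr_sum z) + (\<Sum>z\<in>V. hdeg z * (39/125 * (2 * real d - hdeg z)\<^sup>2))"
    by (simp add: T_def distrib_left sum.distrib)
  also have "\<dots> \<le> real (\<Sum>z\<in>V. d * (hdeg z)\<^sup>2) + (\<Sum>z\<in>V. hdeg z * (39/125 * (2 * real d - hdeg z)\<^sup>2))"
    using sum_hdeg_nbr_sum by (intro add_right_mono) (simp only: of_nat_le_iff)
  also have "\<dots> = (\<Sum>z\<in>V. hdeg z * (d * real (hdeg z) + 39/125 * (2 * real d - hdeg z)\<^sup>2))"
    by (simp add: sum.distrib[symmetric] distrib_left power2_eq_square mult.left_commute)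
  also have "\<dots> \<le> (\<Sum>z\<in>V. hdeg z * (164/125 * (real d)\<^sup>2))"
  proof (intro sum_mono mult_left_mono)
    fix z assume "z \<in> V"
    then have "0 \<le> (real d - hdeg z) * (8/125 * d + 39/125 * hdeg z)"
      using hdeg_le by (intro mult_nonneg_nonneg) auto
    then show "d * real (hdeg z) + 39/125 * (2 * real d - hdeg z)\<^sup>2 \<le> 164/125 * (real d)\<^sup>2"
      by (simp add: power2_eq_square field_simps)
  qed auto
  also have "\<dots> = card P * (164/125 * (real d)\<^sup>2)"
    by (simp only: card_P of_nat_sum sum_distrib_right)
  finally have "card P * real (card P) \<le> card P * (2 * (164/125 * (real d)\<^sup>2))"
    by (simp add: power2_eq_square)
  then show ?thesis
    by (cases "card P = 0") (simp_all add: mult_le_cancel_left_pos)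
qed

end

section \<open>Cliques in the square of the line graph\<close>

lemma (in pair_graph) card_nbrs_le_max_degree:
  assumes "x \<in> pverts G"
  shows "card (nbrs (\<lambda>a b. (a, b) \<in> parcs G) (pverts G) x) \<le> max_degree G"
proof -
  have "nbrs (\<lambda>a b. (a, b) \<in> parcs G) (pverts G) x = snd ` out_arcs (with_proj G) x"
    by (force simp: nbrs_def out_arcs_def dest: in_arcsD2 intro: rev_image_eqI)
  then have "card (nbrs (\<lambda>a b. (a, b) \<in> parcs G) (pverts G) x) \<le> out_degree (with_proj G) x"
    unfolding out_degree_def using pair_finite_arcs by (simp add: card_image_le out_arcs_def)
  also have "\<dots> \<le> max_degree G"
    unfolding max_degree_def using assms by (intro Max_ge) auto
  finally show ?thesis .
qed

lemma line_graph_dist_le_2: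
  assumes "pair_graph G" and "graph_dist (line_graph G) e f \<le> ereal (real 2)"
  obtains "e \<inter> f \<noteq> {}" | "e = f" | a b where "(a, b) \<in> parcs G" "a \<in> e" "b \<in> f"
proof -
  interpret L: pair_graph "line_graph G" using assms(1) by (rule pair_graph_line_graph)
  interpret pair_graph G by fact
  obtain p where p: "L.awalk e p f" "length p \<le> 2"
    using assms(2) graph_dist_le_iff[OF L.wf_digraph_axioms, of e f 2] by auto
  then have aw: "set p \<subseteq> parcs (line_graph G)" "L.cas e p f"
    by (simp_all add: L.awalk_def)
  consider "p = []" | x where "p = [x]" | x y where "p = [x, y]"
    using p(2) by (cases p; cases "tl p"; auto)
  then show thesis
  proof cases
    case 1
    then show ?thesis using aw that(2) by simp
  next
    case 2
    then have "(e, f) \<in> parcs (line_graph G)" using aw by (cases x) auto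
    then show ?thesis using that(1) by (auto simp: line_graph_def)
  next
    case 3
    then have "(e, snd x) \<in> parcs (line_graph G)" "(snd x, f) \<in> parcs (line_graph G)"
      using aw by (cases x; cases y; auto)+
    then obtain g where g: "g \<in> edges G" "e \<inter> g \<noteq> {}" "g \<inter> f \<noteq> {}"
      by (auto simp: line_graph_def)
    then obtain a b where ab: "g = {a, b}" "(a, b) \<in> parcs G" "(b, a) \<in> parcs G"
      by (auto simp: edges_def dest: arcs_symmetric)
    then show ?thesis using g that by blast
  qed
qed

theorem corollary1p7:
  fixes G :: "'a pair_pre_digraph"
  assumes "pair_graph G"
  shows "real (clique_number (graph_power (line_graph G) 2))
           \<le> 2607 / 1987 * (real (max_degree G))\<^sup>2"
proof -
  interpret pair_graph G by fact
  let ?Q = "graph_power (line_graph G) 2"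
  have fin_edges: "finite (edges G)"
    using pair_finite_arcs by (rule finite_surj[of _ _ "\<lambda>(u, v). {u, v}"]) (auto simp: edges_def)
  have QE: "pverts ?Q = edges G" by (simp add: graph_power_def line_graph_def)
  have "finite {C. is_clique ?Q C}"
    using fin_edges by (rule finite_subset[rotated, OF finite_Pow_iff[THEN iffD2]]) (auto simp: is_clique_def QE)
  moreover have "is_clique ?Q {}" by (simp add: is_clique_def)
  ultimately have "clique_number ?Q \<in> card ` {C. is_clique ?Q C}"
    unfolding clique_number_def by (intro Max_in) auto
  then obtain C where C: "is_clique ?Q C" "clique_number ?Q = card C" by auto
  have CE: "C \<subseteq> edges G" using C(1) by (simp add: is_clique_def QE)
  have finC: "finite C" using CE fin_edges by (rule finite_subset)
  have close: "graph_dist (line_graph G) e f \<le> ereal (real 2)" if "e \<in> C" "f \<in> C" "e \<noteq> f" for e f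
    using C(1) that by (simp add: is_clique_def graph_power_def)

  define E where "E a b \<longleftrightarrow> (a, b) \<in> parcs G" for a b
  define P where "P = {(a, b). {a, b} \<in> C}"
  have symE: "E b a" if "E a b" for a b
    using that arcs_symmetric[of a b] by (simp add: E_def)
  have PE: "E a b" if "(a, b) \<in> P" for a b
  proof -
    have "{a, b} \<in> edges G" using that CE by (auto simp: P_def)
    then obtain u v where "{a, b} = {u, v}" "E u v" by (auto simp: edges_def E_def)
    then show ?thesis using symE[of u v] by (auto simp: doubleton_eq_iff)
  qed
  have irrefl: "\<not> E a a" for a using pair_no_loops[of "(a, a)"] by (auto simp: E_def)
  have "strong_arcs E (pverts G) P (max_degree G)"
  proof
    show "P \<subseteq> pverts G \<times> pverts G"
      using PE by (auto simp: E_def dest: in_arcsD1 in_arcsD2)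
    show "(y, x) \<in> P" if "(x, y) \<in> P" for x y
      using that by (simp add: P_def insert_commute)
    show "card (nbrs E (pverts G) x) \<le> max_degree G" if "x \<in> pverts G" for x
      using card_nbrs_le_max_degree[OF that] by (simp add: E_def[abs_def])
    show "E x x' \<or> E y y' \<or> E x y' \<or> E x' y" if xy: "(x, y) \<in> P" and xy': "(x', y') \<in> P" for x y x' y'
    proof -
      have e: "E x y" "E x' y'" using PE xy xy' by auto
      have "{x, y} = {x', y'} \<or> graph_dist (line_graph G) {x, y} {x', y'} \<le> ereal (real 2)"
        using close xy xy' unfolding P_def by blast
      then show ?thesis
      proof
        assume "{x, y} = {x', y'}"
        then show ?thesis using e symE[OF e(1)] by (auto simp: doubleton_eq_iff)
      next
        assume "graph_dist (line_graph G) {x, y} {x', y'} \<le> ereal (real 2)"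
        then show ?thesis
        proof (rule line_graph_dist_le_2[OF \<open>pair_graph G\<close>])
          assume "{x, y} \<inter> {x', y'} \<noteq> {}"
          then show ?thesis using e symE[OF e(1)] symE[OF e(2)] by auto
        next
          assume "{x, y} = {x', y'}"
          then show ?thesis using e symE[OF e(1)] by (auto simp: doubleton_eq_iff)
        next
          fix a b assume "(a, b) \<in> parcs G" "a \<in> {x, y}" "b \<in> {x', y'}"
          then show ?thesis using symE[of a b] by (auto simp: E_def)
        qed
      qed
    qed
  qed (use symE PE in auto)
  then interpret strong_arcs E "pverts G" P "max_degree G" .
  have bound: "real (card P) \<le> 2 * (164/125 * (real (max_degree G))\<^sup>2)"
    by (rule card_arcs_le)
  have "card P = (\<Sum>e\<in>C. card {p \<in> P. {fst p, snd p} = e})"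
  proof -
    have "P = (\<Union>e\<in>C. {p \<in> P. {fst p, snd p} = e})" by (auto simp: P_def)
    then have "card P = card (\<Union>e\<in>C. {p \<in> P. {fst p, snd p} = e})" by (rule arg_cong)
    also have "\<dots> = (\<Sum>e\<in>C. card {p \<in> P. {fst p, snd p} = e})"
      using finC finP by (intro card_UN_disjoint) auto
    finally show ?thesis .
  qed
  also have "\<dots> = (\<Sum>e\<in>C. 2)"
  proof (intro sum.cong refl)
    fix e assume e: "e \<in> C"
    then obtain a b where ab: "e = {a, b}" "(a, b) \<in> parcs G" using CE by (auto simp: edges_def)
    then have "a \<noteq> b" using irrefl by (auto simp: E_def)
    have "{p \<in> P. {fst p, snd p} = e} = {(a, b), (b, a)}"
      using e ab by (auto simp: P_def doubleton_eq_iff insert_commute)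
    then show "card {p \<in> P. {fst p, snd p} = e} = 2" using \<open>a \<noteq> b\<close> by simp
  qed
  finally have "card P = 2 * card C" by simp
  then have "real (card C) \<le> 164/125 * (real (max_degree G))\<^sup>2" using bound by simp
  also have "\<dots> \<le> 2607/1987 * (real (max_degree G))\<^sup>2" by (intro mult_right_mono) auto
  finally show ?thesis by (simp add: C(2))
qed

end
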